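(* Let $n_1,n_2\ge 1$ be integers and let $G$ be a finite tree. The tree $CB(n_1,n_2)$ is friendly to $G$ if and only if both of the following hold: (1) $|E(G)|=n_1+n_2-1$; (2) there exist two subtrees $H_1$ and $H_2$ of $G$ that intersect in exactly one edge and satisfy $|E(H_1)|=n_1$ and $|E(H_2)|=n_2$.
   Context: All trees are finite. The $n$-star is the tree with vertices $0,1,\ldots,n$ and edges $(0,1),(0,2),\ldots,(0,n)$. $CB(n_1,n_2)$ denotes the union of an $n_1$-star and an $n_2$-star along one common edge: it consists of two adjacent vertices $C_1\ne C_2$ (the centers of the two stars) together with $n_1-1$ further leaves attached to $C_1$ and $n_2-1$ further leaves attached to $C_2$. So $\deg C_1=n_1$, $\deg C_2=n_2$, it has $n_1+n_2-1$ edges, and $CB(n,1)$ is the $n$-star. The path between two distinct edges of a tree is the path joining some endpoint of the first to some endpoint of the second and containing neither of the two edges. For two subsets $p,q$ of the edge set of a tree: $p$ does not catch on $q$ if $p\cap q=\varnothing$ and for any two edges of $p$ the path in the tree between them contains an even number of edges of $q$; $p$ and $q$ are unlinked if $p$ does not catch on $q$ and $q$ does not catch on $p$. The coboundary $\delta P$ of a vertex $P$ is the set of edges incident to $P$. A tree $G_1$ is friendly to a tree $G_2$ if there is a bijection $\varphi:E(G_1)\to E(G_2)$ (called a friendly bijection) such that for any two distinct vertices $P,Q$ of $G_1$ joined by a path with an even number of edges, the sets $\varphi(\delta P)$ and $\varphi(\delta Q)$ are unlinked in $G_2$. *)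

theory Defs
  imports Main
begin

record 'a ugraph =
  verts :: "'a set"
  edges :: "'a set set"

definition simple_graph :: "'a ugraph \<Rightarrow> bool" where
  "simple_graph G \<longleftrightarrow> (\<forall>e \<in> edges G. e \<subseteq> verts G \<and> card e = 2)"

text \<open>A path is represented by the list of its pairwise distinct vertices; \<open>[v]\<close> is the path
  without edges at \<open>v\<close>.\<close>

definition is_path :: "'a ugraph \<Rightarrow> 'a list \<Rightarrow> bool" where
  "is_path G xs \<longleftrightarrow> xs \<noteq> [] \<and> distinct xs \<and> set xs \<subseteq> verts G \<and>
     successively (\<lambda>u v. {u, v} \<in> edges G) xs"

fun path_edges :: "'a list \<Rightarrow> 'a set set" where
  "path_edges (u # v # xs) = insert {u, v} (path_edges (v # xs))"
| "path_edges _ = {}"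

definition is_path_between :: "'a ugraph \<Rightarrow> 'a \<Rightarrow> 'a list \<Rightarrow> 'a \<Rightarrow> bool" where
  "is_path_between G u xs v \<longleftrightarrow> is_path G xs \<and> hd xs = u \<and> last xs = v"

definition connected_graph :: "'a ugraph \<Rightarrow> bool" where
  "connected_graph G \<longleftrightarrow> verts G \<noteq> {} \<and>
     (\<forall>u \<in> verts G. \<forall>v \<in> verts G. \<exists>xs. is_path_between G u xs v)"

definition is_cycle :: "'a ugraph \<Rightarrow> 'a list \<Rightarrow> bool" where
  "is_cycle G xs \<longleftrightarrow> is_path G xs \<and> length xs \<ge> 3 \<and> {last xs, hd xs} \<in> edges G"

definition tree :: "'a ugraph \<Rightarrow> bool" where
  "tree G \<longleftrightarrow> simple_graph G \<and> finite (verts G) \<and> connected_graph G \<and> (\<nexists>xs. is_cycle G xs)"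

definition subtree :: "'a ugraph \<Rightarrow> 'a ugraph \<Rightarrow> bool" where
  "subtree H G \<longleftrightarrow> verts H \<subseteq> verts G \<and> edges H \<subseteq> edges G \<and> tree H"

definition is_edge_path :: "'a ugraph \<Rightarrow> 'a set \<Rightarrow> 'a list \<Rightarrow> 'a set \<Rightarrow> bool" where
  "is_edge_path G e xs f \<longleftrightarrow> is_path G xs \<and> hd xs \<in> e \<and> last xs \<in> f \<and>
     e \<notin> path_edges xs \<and> f \<notin> path_edges xs"

text \<open>In a tree there is exactly one path between two distinct edges, so the quantifier over
  \<open>xs\<close> below ranges over a single path.\<close>

definition not_catch_on :: "'a ugraph \<Rightarrow> 'a set set \<Rightarrow> 'a set set \<Rightarrow> bool" where
  "not_catch_on G p q \<longleftrightarrow> p \<inter> q = {} \<and>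
     (\<forall>e \<in> p. \<forall>f \<in> p. e \<noteq> f \<longrightarrow>
        (\<forall>xs. is_edge_path G e xs f \<longrightarrow> even (card (path_edges xs \<inter> q))))"

definition unlinked :: "'a ugraph \<Rightarrow> 'a set set \<Rightarrow> 'a set set \<Rightarrow> bool" where
  "unlinked G p q \<longleftrightarrow> not_catch_on G p q \<and> not_catch_on G q p"

definition coboundary :: "'a ugraph \<Rightarrow> 'a \<Rightarrow> 'a set set" where
  "coboundary G v = {e \<in> edges G. v \<in> e}"

definition friendly_bijection ::
  "'a ugraph \<Rightarrow> 'b ugraph \<Rightarrow> ('a set \<Rightarrow> 'b set) \<Rightarrow> bool" where
  "friendly_bijection G1 G2 \<phi> \<longleftrightarrow> bij_betw \<phi> (edges G1) (edges G2) \<and>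
     (\<forall>P \<in> verts G1. \<forall>Q \<in> verts G1.
        P \<noteq> Q \<and> (\<exists>xs. is_path_between G1 P xs Q \<and> even (card (path_edges xs))) \<longrightarrow>
        unlinked G2 (\<phi> ` coboundary G1 P) (\<phi> ` coboundary G1 Q))"

definition friendly :: "'a ugraph \<Rightarrow> 'b ugraph \<Rightarrow> bool" where
  "friendly G1 G2 \<longleftrightarrow> (\<exists>\<phi>. friendly_bijection G1 G2 \<phi>)"

datatype cb_vertex = Center1 | Center2 | Leaf1 nat | Leaf2 nat

definition CB :: "nat \<Rightarrow> nat \<Rightarrow> cb_vertex ugraph" where
  "CB n1 n2 =
     \<lparr> verts = {Center1, Center2} \<union> Leaf1 ` {1..<n1} \<union> Leaf2 ` {1..<n2},
       edges = {{Center1, Center2}}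
         \<union> {{Center1, Leaf1 i} | i. i \<in> {1..<n1}}
         \<union> {{Center2, Leaf2 i} | i. i \<in> {1..<n2}} \<rparr>"

end

theory Submission
  imports Defs
begin

text \<open>In \<open>CB n1 n2\<close> the only informative pairs of vertices at even distance consist of a centre and
  a leaf of the other star, since two one-element sets are always unlinked. Unlinkedness of the
  image \<open>S\<close> of a star with every edge outside \<open>S\<close> says that the path of \<open>G\<close> between any two edges of
  \<open>S\<close> stays in \<open>S\<close>, i.e. that \<open>S\<close> is the edge set of a subtree. So friendly bijections are exactly
  the bijections that map both stars to subtrees, and by counting two subtrees sharing one edge
  arise this way if and only if \<open>G\<close> has \<open>n1 + n2 - 1\<close> edges.\<close>

section \<open>Paths in trees\<close>

lemma path_edges_subset_set: "x \<in> path_edges xs \<Longrightarrow> x \<subseteq> set xs"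
  by (induction xs rule: path_edges.induct) auto

lemma finite_path_edges: "finite (path_edges xs)"
  by (induction xs rule: path_edges.induct) auto

lemma path_edges_snoc:
  "path_edges (xs @ [u, v]) = insert {u, v} (path_edges (xs @ [u]))"
  by (induction xs rule: path_edges.induct) auto

lemma path_edges_rev: "path_edges (rev xs) = path_edges xs"
  by (induction xs rule: path_edges.induct) (auto simp: path_edges_snoc insert_commute)

lemma successively_edges_iff:
  "successively (\<lambda>u v. {u, v} \<in> E) xs \<longleftrightarrow> path_edges xs \<subseteq> E"
  by (induction xs rule: path_edges.induct) auto

text \<open>With adjacency turned into an inclusion of edge sets, reversing a path or passing to a
  larger graph becomes a matter of sets.\<close>

lemma is_path_iff:
  "is_path G xs \<longleftrightarrow> xs \<noteq> [] \<and> distinct xs \<and> set xs \<subseteq> verts G \<and> path_edges xs \<subseteq> edges G"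
  unfolding is_path_def successively_edges_iff ..

lemma is_path_rev: "is_path G (rev xs) \<longleftrightarrow> is_path G xs"
  by (simp add: is_path_iff path_edges_rev)

lemma path_edges_cover: "length xs \<ge> 2 \<Longrightarrow> set xs \<subseteq> \<Union> (path_edges xs)"
proof (induction xs rule: path_edges.induct)
  case (1 u v xs)
  then show ?case by (cases xs) auto
qed auto

text \<open>Between two occurrences of a repeated vertex \<open>y\<close> the walk is a detour.
  Cutting it out shortens the walk and keeps its ends, so induction on the length applies.\<close>

lemma walk_contains_path:
  assumes "xs \<noteq> []" "successively R xs"
  shows "\<exists>ys. ys \<noteq> [] \<and> distinct ys \<and> successively R ys \<and> hd ys = hd xs \<and> last ys = last xs
    \<and> set ys \<subseteq> set xs"
  using assms
proof (induction "length xs" arbitrary: xs rule: less_induct)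
  case less
  show ?case
  proof (cases "distinct xs")
    case True
    with less.prems show ?thesis by blast
  next
    case False
    then obtain as bs cs y where xs: "xs = as @ [y] @ bs @ [y] @ cs"
      using not_distinct_decomp by blast
    let ?zs = "as @ [y] @ cs"
    have "successively R ?zs"
      using less.prems(2) by (auto simp: xs successively_append_iff successively_Cons)
    then obtain ys where "ys \<noteq> []" "distinct ys" "successively R ys" "hd ys = hd ?zs"
        "last ys = last ?zs" "set ys \<subseteq> set ?zs"
      using less.hyps[of ?zs] by (auto simp: xs)
    moreover have "hd ?zs = hd xs" "last ?zs = last xs" "set ?zs \<subseteq> set xs"
      by (auto simp: xs hd_append last_append)
    ultimately show ?thesis by (metis subset_trans)
  qed
qed

text \<open>Where two paths from \<open>u\<close> diverge to \<open>a\<close> and \<open>b\<close>,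
  both remainders avoid \<open>u\<close> and end at \<open>v\<close>. Joined at \<open>v\<close>
  they contain a path from \<open>a\<close> to \<open>b\<close>, which \<open>u\<close> closes to a
  cycle.\<close>

lemma acyclic_path_unique:
  assumes "\<nexists>zs. is_cycle G zs" "is_path_between G u xs v" "is_path_between G u ys v"
  shows "xs = ys"
  using assms(2,3)
proof (induction xs arbitrary: u ys)
  case Nil
  then show ?case by (simp add: is_path_between_def is_path_def)
next
  case (Cons w xs)
  then have w: "w = u" by (simp add: is_path_between_def)
  obtain ys' where ys: "ys = u # ys'"
    using Cons.prems(2) by (cases ys) (auto simp: is_path_between_def is_path_def)
  show ?case
  proof (cases "xs = [] \<or> ys' = []")
    \<comment> \<open>One of the paths is \<open>[u]\<close>, so \<open>u = v\<close>; the other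
      path then starts and ends at \<open>u\<close> and is \<open>[u]\<close> by
      distinctness.\<close>
    case True
    then show ?thesis
      using Cons.prems w ys
      by (auto simp: is_path_between_def is_path_def split: if_splits dest: last_in_set)
  next
    case False
    then obtain a r b s where xs: "xs = a # r" and ys': "ys' = b # s"
      by (meson neq_Nil_conv)
    show ?thesis
    proof (cases "a = b")
      case True
      have "is_path_between G a xs v" "is_path_between G a ys' v"
        using Cons.prems w ys True by (auto simp: is_path_between_def is_path_def xs ys')
      with Cons.IH show ?thesis by (simp add: w ys)
    next
      case ab: False
      let ?R = "\<lambda>u v. {u, v} \<in> edges G"
      \<comment> \<open>From \<open>a\<close> along \<open>xs\<close> to \<open>v\<close> and back
        along \<open>ys'\<close> to \<open>b\<close>; \<open>tl\<close> removes the second copy of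
        \<open>v\<close>.\<close>
      let ?walk = "xs @ tl (rev ys')"
      have R: "successively ?R (a # r)" "successively ?R (rev ys')" "?R u a" "?R u b"
          "u \<notin> set xs" "u \<notin> set ys'" "set xs \<subseteq> verts G" "set ys' \<subseteq> verts G" "u \<in> verts G"
          "last xs = v" "last ys' = v"
        using Cons.prems w ys
        by (auto simp: is_path_between_def is_path_def xs ys' successively_rev insert_commute
            simp del: rev.simps)
      obtain t where t: "rev ys' = v # t"
        using R(11) ys' by (metis hd_rev list.collapse list.distinct(1) rev_is_Nil_conv)
      have "successively ?R ?walk"
        using R(1)[folded xs] R(2,10) by (auto simp: t successively_append_iff successively_Cons)
      moreover have "last ?walk = b"
        using R(10) t ys' by (metis last_append last_rev list.sel(1,3) last_ConsL last_ConsR)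
      moreover have "set ?walk \<subseteq> set xs \<union> set ys'"
        using arg_cong[OF t, of set] by (auto simp: t simp del: set_rev simp flip: set_rev[of ys'])
      ultimately obtain p where p: "p \<noteq> []" "distinct p" "successively ?R p" "hd p = a"
          "last p = b" "set p \<subseteq> set xs \<union> set ys'"
        using walk_contains_path[of ?walk ?R] xs by (auto simp: subset_iff)
      \<comment> \<open>Since \<open>a\<close> and \<open>b\<close> differ, \<open>u # p\<close>
        reaches the three vertices that \<open>is_cycle\<close> demands.\<close>
      then have "length p \<ge> 2"
        using ab by (cases p; cases "tl p") auto
      moreover have "is_path G (u # p)"
        using p R by (cases p) (auto simp: is_path_def successively_Cons)
      ultimately have "is_cycle G (u # p)"
        using p R(4) by (auto simp: is_cycle_def insert_commute)
      with assms(1) show ?thesis by blast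
    qed
  qed
qed

text \<open>A path starting at an endpoint of \<open>e\<close> never returns to that endpoint, so it
  can use \<open>e\<close> only as its first edge. Deleting the first vertex then leaves a path that
  starts at the other endpoint of \<open>e\<close>.\<close>

lemma drop_initial_edge:
  assumes "is_path G xs" "hd xs \<in> e" "card e = 2"
  shows "\<exists>ys. is_path G ys \<and> hd ys \<in> e \<and> last ys = last xs \<and> e \<notin> path_edges ys
    \<and> path_edges ys \<subseteq> path_edges xs \<and> path_edges xs \<subseteq> insert e (path_edges ys)"
proof (cases "e \<in> path_edges xs")
  case False
  with assms show ?thesis by blast
next
  case True
  then obtain u w r where xs: "xs = u # w # r"
    by (cases xs rule: path_edges.cases) auto
  have "u \<notin> set (w # r)" "u \<in> e"
    using assms by (auto simp: xs is_path_iff)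
  then have "e \<notin> path_edges (w # r)"
    using path_edges_subset_set by blast
  with True have "e = {u, w}" by (simp add: xs)
  with assms \<open>e \<notin> path_edges (w # r)\<close> show ?thesis
    by (intro exI[of _ "w # r"]) (auto simp: xs is_path_iff)
qed

text \<open>The initial edge is dropped once from the path and once from its reversal, so that at
  most \<open>e\<close> and \<open>f\<close> are lost. This links paths between vertices to the
  paths between edges used in \<open>not_catch_on\<close>.\<close>

lemma path_contains_edge_path:
  assumes "is_path G xs" "hd xs \<in> e" "last xs \<in> f" "card e = 2" "card f = 2"
  shows "\<exists>ys. is_edge_path G e ys f \<and> path_edges xs \<subseteq> {e, f} \<union> path_edges ys"
proof -
  obtain ys where ys: "is_path G ys" "hd ys \<in> e" "last ys = last xs" "e \<notin> path_edges ys"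
      "path_edges xs \<subseteq> insert e (path_edges ys)"
    using drop_initial_edge assms by metis
  have "is_path G (rev ys)" "hd (rev ys) \<in> f"
    using ys assms(3) by (auto simp: is_path_rev hd_rev)
  then obtain zs where zs: "is_path G zs" "hd zs \<in> f" "last zs = last (rev ys)"
      "f \<notin> path_edges zs" "path_edges zs \<subseteq> path_edges (rev ys)"
      "path_edges (rev ys) \<subseteq> insert f (path_edges zs)"
    using drop_initial_edge assms(5) by metis
  have "is_edge_path G e (rev zs) f"
    using ys zs by (auto simp: is_edge_path_def is_path_rev path_edges_rev hd_rev last_rev)
  moreover have "path_edges xs \<subseteq> {e, f} \<union> path_edges (rev zs)"
    using ys(5) zs(6) by (auto simp: path_edges_rev)
  ultimately show ?thesis by blast
qed

section \<open>Edge sets of subtrees\<close>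

text \<open>Against a single edge \<open>q\<close> the parity condition becomes avoidance: a path
  contains either none or exactly one element of \<open>{q}\<close>.\<close>

lemma not_catch_on_singleton:
  "not_catch_on G S {q} \<longleftrightarrow> q \<notin> S \<and>
    (\<forall>e \<in> S. \<forall>f \<in> S. e \<noteq> f \<longrightarrow> (\<forall>xs. is_edge_path G e xs f \<longrightarrow> q \<notin> path_edges xs))"
proof -
  have "even (card (A \<inter> {q})) \<longleftrightarrow> q \<notin> A" for A by (cases "q \<in> A") auto
  then show ?thesis by (auto simp: not_catch_on_def)
qed

text \<open>A one-element set contains no two distinct edges, so the reverse condition reduces to
  disjointness.\<close>

lemma unlinked_singleton: "unlinked G S {q} \<longleftrightarrow> not_catch_on G S {q}"
  by (auto simp: unlinked_def not_catch_on_def)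

lemma unlinked_commute: "unlinked G p q \<longleftrightarrow> unlinked G q p"
  by (auto simp: unlinked_def)

lemma path_mono:
  assumes "verts H \<subseteq> verts G" "edges H \<subseteq> edges G" "is_path H xs"
  shows "is_path G xs"
  using assms by (auto simp: is_path_iff)

text \<open>By uniqueness of paths in \<open>G\<close>, a path joining endpoints of two edges of
  \<open>H\<close> is the path inside \<open>H\<close>, and so misses \<open>q\<close>.\<close>

lemma subtree_not_catch_on:
  assumes "tree G" "subtree H G" "q \<notin> edges H"
  shows "not_catch_on G (edges H) {q}"
  unfolding not_catch_on_singleton
proof (intro conjI ballI allI impI)
  fix e f xs
  assume ef: "e \<in> edges H" "f \<in> edges H" and xs: "is_edge_path G e xs f"
  have "tree H" using assms(2) by (simp add: subtree_def)
  then have "hd xs \<in> verts H" "last xs \<in> verts H"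
    using ef xs by (auto simp: tree_def simple_graph_def is_edge_path_def)
  with \<open>tree H\<close> obtain ys where ys: "is_path_between H (hd xs) ys (last xs)"
    unfolding tree_def connected_graph_def by blast
  then have "is_path_between G (hd xs) ys (last xs)"
    using assms(2) path_mono by (fastforce simp: is_path_between_def subtree_def)
  moreover have "is_path_between G (hd xs) xs (last xs)"
    using xs by (simp add: is_path_between_def is_edge_path_def)
  ultimately have "xs = ys"
    using assms(1) acyclic_path_unique by (metis tree_def)
  then have "path_edges xs \<subseteq> edges H"
    using ys by (simp add: is_path_between_def is_path_iff)
  with assms(3) show "q \<notin> path_edges xs" by blast
qed (rule assms(3))

text \<open>Acyclicity is inherited from \<open>G\<close>; the content is connectedness. The path of
  \<open>G\<close> between two vertices covered by \<open>S\<close> cannot leave \<open>S\<close>,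
  as an edge outside \<open>S\<close> on it would be caught on.\<close>

lemma subtree_of_not_catch_on:
  assumes "tree G" "S \<subseteq> edges G" "S \<noteq> {}" "\<And>q. q \<in> edges G - S \<Longrightarrow> not_catch_on G S {q}"
  shows "subtree \<lparr>verts = \<Union>S, edges = S\<rparr> G"
proof -
  let ?H = "\<lparr>verts = \<Union>S, edges = S\<rparr>"
  have edge: "e \<subseteq> verts G" "card e = 2" if "e \<in> S" for e
    using assms(1,2) that by (auto simp: tree_def simple_graph_def)
  then have sub: "\<Union>S \<subseteq> verts G" by blast
  have fin: "finite (\<Union>S)"
    using sub assms(1) by (auto simp: tree_def intro: finite_subset)
  have conn: "\<exists>xs. is_path_between ?H u xs v" if uv: "u \<in> \<Union>S" "v \<in> \<Union>S" for u v
  proof -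
    obtain e f where ef: "e \<in> S" "f \<in> S" "u \<in> e" "v \<in> f" using uv by blast
    consider "u = v" | "e = f" "u \<noteq> v" | "e \<noteq> f" "u \<noteq> v" by blast
    then show ?thesis
    proof cases
      case 1
      then show ?thesis
        using uv by (intro exI[of _ "[u]"]) (auto simp: is_path_between_def is_path_iff)
    next
      case 2
      then have "e = {u, v}"
        using edge(2)[of e] ef by (auto simp: card_2_iff)
      with 2 ef show ?thesis
        by (intro exI[of _ "[u, v]"]) (auto simp: is_path_between_def is_path_iff)
    next
      case 3
      obtain xs where xs: "is_path G xs" "hd xs = u" "last xs = v"
        using assms(1) uv sub
        unfolding tree_def connected_graph_def is_path_between_def by blast
      \<comment> \<open>The path \<open>xs\<close> may run through \<open>e\<close> or
        \<open>f\<close> itself, whereas the hypothesis on \<open>S\<close> speaks only of paths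
        avoiding both.\<close>
      obtain ys where ys: "is_edge_path G e ys f" "path_edges xs \<subseteq> {e, f} \<union> path_edges ys"
        using path_contains_edge_path[of G xs e f] xs ef edge by auto
      have "path_edges ys \<subseteq> S"
      proof
        fix q assume q: "q \<in> path_edges ys"
        then have "q \<in> edges G" using ys(1) by (auto simp: is_edge_path_def is_path_iff)
        then show "q \<in> S"
          using assms(4)[of q] q ys(1) ef 3 by (auto simp: not_catch_on_singleton)
      qed
      with ys(2) ef have xsS: "path_edges xs \<subseteq> S" by blast
      \<comment> \<open>A path with at least two vertices has each vertex on one of its edges, so
        its vertices lie in the vertex set of \<open>?H\<close>.\<close>
      have "length xs \<ge> 2"
        using 3 xs by (cases xs; cases "tl xs") (auto simp: is_path_iff)
      then have "set xs \<subseteq> \<Union>S"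
        using path_edges_cover[of xs] Union_mono[OF xsS] by simp
      then have "is_path ?H xs"
        using xs(1) xsS by (simp add: is_path_iff)
      with xs show ?thesis by (auto simp: is_path_between_def)
    qed
  qed
  have "\<Union>S \<noteq> {}"
    using assms(3) edge(2) by fastforce
  moreover have "\<nexists>xs. is_cycle ?H xs"
    using assms(1,2) path_mono[of ?H G] sub by (auto simp: tree_def is_cycle_def)
  moreover have "simple_graph ?H"
    using edge(2) by (auto simp: simple_graph_def)
  ultimately show ?thesis
    using fin conn sub assms(2) by (auto simp: subtree_def tree_def connected_graph_def)
qed

lemma subtree_edge_set_iff:
  assumes "tree G" "S \<subseteq> edges G" "S \<noteq> {}"
  shows "(\<exists>H. subtree H G \<and> edges H = S) \<longleftrightarrow> (\<forall>q \<in> edges G - S. not_catch_on G S {q})"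
proof
  assume "\<forall>q \<in> edges G - S. not_catch_on G S {q}"
  then show "\<exists>H. subtree H G \<and> edges H = S"
    using subtree_of_not_catch_on[OF assms] by (metis select_convs(2))
qed (use assms(1) subtree_not_catch_on in blast)

section \<open>Friendly bijections from \<open>CB n1 n2\<close>\<close>

text \<open>The common edge of the two stars is left out, so that the edges of
  \<open>CB n1 n2\<close> split into three disjoint pieces.\<close>

definition spokes1 :: "nat \<Rightarrow> cb_vertex set set" where
  "spokes1 n = (\<lambda>i. {Center1, Leaf1 i}) ` {1..<n}"

definition spokes2 :: "nat \<Rightarrow> cb_vertex set set" where
  "spokes2 n = (\<lambda>i. {Center2, Leaf2 i}) ` {1..<n}"

lemma edges_CB:
  "edges (CB n1 n2) = insert {Center1, Center2} (spokes1 n1 \<union> spokes2 n2)"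
  by (auto simp: CB_def spokes1_def spokes2_def)

lemma finite_spokes: "finite (spokes1 n)" "finite (spokes2 n)"
  by (simp_all add: spokes1_def spokes2_def)

lemma card_spokes: "card (spokes1 n) = n - 1" "card (spokes2 n) = n - 1"
  unfolding spokes1_def spokes2_def
  by (subst card_image; auto simp: inj_on_def doubleton_eq_iff)+

lemma spokes_disjoint:
  "spokes1 m \<inter> spokes2 n = {}" "{Center1, Center2} \<notin> spokes1 m" "{Center1, Center2} \<notin> spokes2 n"
  by (auto simp: spokes1_def spokes2_def doubleton_eq_iff)

lemma coboundary_CB:
  "coboundary (CB n1 n2) Center1 = insert {Center1, Center2} (spokes1 n1)"
  "coboundary (CB n1 n2) Center2 = insert {Center1, Center2} (spokes2 n2)"
  "i \<in> {1..<n1} \<Longrightarrow> coboundary (CB n1 n2) (Leaf1 i) = {{Center1, Leaf1 i}}"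
  "j \<in> {1..<n2} \<Longrightarrow> coboundary (CB n1 n2) (Leaf2 j) = {{Center2, Leaf2 j}}"
  by (auto simp: coboundary_def edges_CB spokes1_def spokes2_def)

text \<open>The bipartition of \<open>CB n1 n2\<close>: the centres have different colours, and each
  leaf has the colour opposite to its own centre.\<close>

fun cb_colour :: "cb_vertex \<Rightarrow> bool" where
  "cb_colour Center1 = True"
| "cb_colour Center2 = False"
| "cb_colour (Leaf1 i) = False"
| "cb_colour (Leaf2 i) = True"

text \<open>Every edge of the path switches the colour.\<close>

lemma even_path_CB_iff:
  assumes "is_path (CB n1 n2) xs"
  shows "even (card (path_edges xs)) \<longleftrightarrow> cb_colour (hd xs) = cb_colour (last xs)"
  using assms
proof (induction xs rule: path_edges.induct)
  case (1 u v xs)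
  \<comment> \<open>As \<open>u\<close> does not recur on the path, the first edge raises the
    cardinality by exactly one.\<close>
  have "{u, v} \<notin> path_edges (v # xs)"
    using 1(2) path_edges_subset_set[of "{u, v}" "v # xs"] by (auto simp: is_path_iff)
  moreover have "cb_colour u \<noteq> cb_colour v"
    using 1(2) by (auto simp: is_path_iff edges_CB spokes1_def spokes2_def doubleton_eq_iff)
  moreover have "is_path (CB n1 n2) (v # xs)"
    using 1(2) by (auto simp: is_path_iff)
  ultimately show ?case
    using 1(1) by (auto simp: finite_path_edges)
qed (auto simp: is_path_iff)

text \<open>Lists the pairs to which friendliness applies: a centre with a leaf of the other star,
  or two leaves of one star. Leaves of different stars have different colours.\<close>

lemma same_colour_CB_iff:
  assumes "P \<in> verts (CB n1 n2)" "Q \<in> verts (CB n1 n2)"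
  shows "P \<noteq> Q \<and> cb_colour P = cb_colour Q \<longleftrightarrow>
    (\<exists>i \<in> {1..<n1}. P = Center2 \<and> Q = Leaf1 i \<or> P = Leaf1 i \<and> Q = Center2) \<or>
    (\<exists>j \<in> {1..<n2}. P = Center1 \<and> Q = Leaf2 j \<or> P = Leaf2 j \<and> Q = Center1) \<or>
    (\<exists>i \<in> {1..<n1}. \<exists>j \<in> {1..<n1}. i \<noteq> j \<and> P = Leaf1 i \<and> Q = Leaf1 j) \<or>
    (\<exists>i \<in> {1..<n2}. \<exists>j \<in> {1..<n2}. i \<noteq> j \<and> P = Leaf2 i \<and> Q = Leaf2 j)"
  using assms by (cases P; cases Q) (auto simp: CB_def)

text \<open>Only the pairs of a centre and a leaf of the other star give conditions; for two leaves
  of one star injectivity of \<open>\<phi>\<close> suffices.\<close>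

lemma friendly_bijection_CB_iff_unlinked:
  "friendly_bijection (CB n1 n2) G \<phi> \<longleftrightarrow> bij_betw \<phi> (edges (CB n1 n2)) (edges G) \<and>
    (\<forall>b \<in> spokes2 n2. unlinked G (\<phi> ` insert {Center1, Center2} (spokes1 n1)) {\<phi> b}) \<and>
    (\<forall>a \<in> spokes1 n1. unlinked G (\<phi> ` insert {Center1, Center2} (spokes2 n2)) {\<phi> a})"
    (is "?L \<longleftrightarrow> ?B \<and> ?U1 \<and> ?U2")
proof
  assume L: ?L
  have U: "unlinked G (\<phi> ` coboundary (CB n1 n2) P) (\<phi> ` coboundary (CB n1 n2) Q)"
    if xs: "is_path (CB n1 n2) xs" "P = hd xs" "Q = last xs" "P \<noteq> Q" "cb_colour P = cb_colour Q"
    for P Q xs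
  proof -
    have "P \<in> verts (CB n1 n2)" "Q \<in> verts (CB n1 n2)"
      using xs(1-3) by (auto simp: is_path_iff)
    then show ?thesis
      using L xs even_path_CB_iff[OF xs(1)]
      unfolding friendly_bijection_def is_path_between_def by blast
  qed
  have ?U1
  proof
    fix b assume "b \<in> spokes2 n2"
    then obtain j where j: "b = {Center2, Leaf2 j}" "j \<in> {1..<n2}" by (auto simp: spokes2_def)
    \<comment> \<open>This path has two edges, so friendliness applies to its ends, whose
      coboundaries are the first star and the single edge \<open>b\<close>.\<close>
    then have "is_path (CB n1 n2) [Center1, Center2, Leaf2 j]"
      by (auto simp: is_path_iff CB_def)
    from U[OF this refl refl] show
      "unlinked G (\<phi> ` insert {Center1, Center2} (spokes1 n1)) {\<phi> b}"
      using j by (simp add: coboundary_CB)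
  qed
  moreover have ?U2
  proof
    fix a assume "a \<in> spokes1 n1"
    then obtain i where i: "a = {Center1, Leaf1 i}" "i \<in> {1..<n1}" by (auto simp: spokes1_def)
    then have "is_path (CB n1 n2) [Center2, Center1, Leaf1 i]"
      by (auto simp: is_path_iff CB_def insert_commute)
    from U[OF this refl refl] show
      "unlinked G (\<phi> ` insert {Center1, Center2} (spokes2 n2)) {\<phi> a}"
      using i by (simp add: coboundary_CB)
  qed
  ultimately show "?B \<and> ?U1 \<and> ?U2"
    using L by (simp add: friendly_bijection_def)
next
  assume R: "?B \<and> ?U1 \<and> ?U2"
  have inj: "inj_on \<phi> (edges (CB n1 n2))" using R by (simp add: bij_betw_def)
  \<comment> \<open>Settles the pairs of leaves, whose coboundaries are single edges.\<close>
  have single: "unlinked G {\<phi> x} {\<phi> y}"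
    if "x \<in> edges (CB n1 n2)" "y \<in> edges (CB n1 n2)" "x \<noteq> y" for x y
    using inj that by (auto simp: unlinked_singleton not_catch_on_singleton inj_on_eq_iff)
  have "unlinked G (\<phi> ` coboundary (CB n1 n2) P) (\<phi> ` coboundary (CB n1 n2) Q)"
    if PQ: "P \<in> verts (CB n1 n2)" "Q \<in> verts (CB n1 n2)" "P \<noteq> Q"
      and xs: "is_path_between (CB n1 n2) P xs Q" "even (card (path_edges xs))"
    for P Q xs
  proof -
    have "cb_colour P = cb_colour Q"
      using xs even_path_CB_iff by (auto simp: is_path_between_def)
    with PQ(3) same_colour_CB_iff[OF PQ(1,2)] consider
        i where "i \<in> {1..<n1}" "P = Center2 \<and> Q = Leaf1 i \<or> P = Leaf1 i \<and> Q = Center2"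
      | j where "j \<in> {1..<n2}" "P = Center1 \<and> Q = Leaf2 j \<or> P = Leaf2 j \<and> Q = Center1"
      | i j where "i \<in> {1..<n1}" "j \<in> {1..<n1}" "i \<noteq> j" "P = Leaf1 i" "Q = Leaf1 j"
      | i j where "i \<in> {1..<n2}" "j \<in> {1..<n2}" "i \<noteq> j" "P = Leaf2 i" "Q = Leaf2 j"
      by blast
    then show ?thesis
    proof cases
      case 1
      then have "{Center1, Leaf1 i} \<in> spokes1 n1" by (auto simp: spokes1_def)
      then have "unlinked G (\<phi> ` insert {Center1, Center2} (spokes2 n2)) {\<phi> {Center1, Leaf1 i}}"
        using R by blast
      with 1 show ?thesis
        using unlinked_commute by (fastforce simp: coboundary_CB)
    next
      case 2
      then have "{Center2, Leaf2 j} \<in> spokes2 n2" by (auto simp: spokes2_def)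
      then have "unlinked G (\<phi> ` insert {Center1, Center2} (spokes1 n1)) {\<phi> {Center2, Leaf2 j}}"
        using R by blast
      with 2 show ?thesis
        using unlinked_commute by (fastforce simp: coboundary_CB)
    next
      case 3
      then show ?thesis
        using single[of "{Center1, Leaf1 i}" "{Center1, Leaf1 j}"]
        by (auto simp: coboundary_CB edges_CB spokes1_def doubleton_eq_iff)
    next
      case 4
      then show ?thesis
        using single[of "{Center2, Leaf2 i}" "{Center2, Leaf2 j}"]
        by (auto simp: coboundary_CB edges_CB spokes2_def doubleton_eq_iff)
    qed
  qed
  with R show ?L by (auto simp: friendly_bijection_def)
qed

text \<open>The edges outside one star are the spokes of the other, and \<open>\<phi>\<close>
  carries complements to complements. So the unlinking conditions on the spokes are the criterion of
  \<open>subtree_edge_set_iff\<close> for the images of the two stars.\<close>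

lemma friendly_bijection_CB_iff:
  assumes "tree G"
  shows "friendly_bijection (CB n1 n2) G \<phi> \<longleftrightarrow> bij_betw \<phi> (edges (CB n1 n2)) (edges G) \<and>
    (\<exists>H1. subtree H1 G \<and> edges H1 = \<phi> ` insert {Center1, Center2} (spokes1 n1)) \<and>
    (\<exists>H2. subtree H2 G \<and> edges H2 = \<phi> ` insert {Center1, Center2} (spokes2 n2))"
proof (cases "bij_betw \<phi> (edges (CB n1 n2)) (edges G)")
  case True
  have compl: "edges G - \<phi> ` A = \<phi> ` (edges (CB n1 n2) - A)" if "A \<subseteq> edges (CB n1 n2)" for A
    using True that by (auto simp: bij_betw_def inj_on_image_set_diff[of \<phi> "edges (CB n1 n2)"])
  let ?S1 = "insert {Center1, Center2} (spokes1 n1)"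
  let ?S2 = "insert {Center1, Center2} (spokes2 n2)"
  have sub: "?S1 \<subseteq> edges (CB n1 n2)" "?S2 \<subseteq> edges (CB n1 n2)" by (auto simp: edges_CB)
  have diff: "edges (CB n1 n2) - ?S1 = spokes2 n2" "edges (CB n1 n2) - ?S2 = spokes1 n1"
    using spokes_disjoint(1)[of n1 n2] spokes_disjoint(2)[of n1] spokes_disjoint(3)[of n2]
    by (auto simp: edges_CB)
  have "(\<exists>H. subtree H G \<and> edges H = \<phi> ` S) \<longleftrightarrow>
      (\<forall>x \<in> edges (CB n1 n2) - S. unlinked G (\<phi> ` S) {\<phi> x})"
    if "S \<subseteq> edges (CB n1 n2)" "S \<noteq> {}" for S
  proof -
    have "\<phi> ` S \<subseteq> edges G" using True that(1) by (auto simp: bij_betw_def)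
    then show ?thesis
      using subtree_edge_set_iff[OF assms, of "\<phi> ` S"] that compl
      by (simp add: unlinked_singleton)
  qed
  from this[OF sub(1)] this[OF sub(2)] show ?thesis
    unfolding friendly_bijection_CB_iff_unlinked diff by simp
qed (simp add: friendly_bijection_def)

text \<open>The bijection is glued from three disjoint pieces: the spokes of each star go to
  \<open>E1 - {e}\<close> and \<open>E2 - {e}\<close>, which have matching sizes, and the common
  edge goes to \<open>e\<close>.\<close>

lemma bij_betw_CB_edges_exists:
  assumes "finite E" "E1 \<union> E2 = E" "E1 \<inter> E2 = {e}" "card E1 = n1" "card E2 = n2"
  shows "\<exists>\<phi>. bij_betw \<phi> (edges (CB n1 n2)) E \<and>
    \<phi> ` insert {Center1, Center2} (spokes1 n1) = E1 \<and>
    \<phi> ` insert {Center1, Center2} (spokes2 n2) = E2"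
proof -
  have fin: "finite E1" "finite E2" and e: "e \<in> E1" "e \<in> E2"
    using assms(1-3) by auto
  have "card (spokes1 n1) = card (E1 - {e})" "card (spokes2 n2) = card (E2 - {e})"
    using assms(4,5) fin e by (simp_all add: card_spokes)
  then obtain f g where f: "bij_betw f (spokes1 n1) (E1 - {e})"
      and g: "bij_betw g (spokes2 n2) (E2 - {e})"
    using finite_same_card_bij finite_spokes fin by (metis finite_Diff)
  \<comment> \<open>Among the edges of \<open>CB n1 n2\<close>, only the common edge of the stars
    reaches the last branch.\<close>
  define \<phi> where "\<phi> x = (if x \<in> spokes1 n1 then f x else if x \<in> spokes2 n2 then g x else e)" for x
  have 1: "bij_betw \<phi> (spokes1 n1) (E1 - {e})"
    using f by (rule bij_betw_cong[THEN iffD1, rotated]) (simp add: \<phi>_def)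
  have 2: "bij_betw \<phi> (spokes2 n2) (E2 - {e})"
    using g spokes_disjoint(1)[of n1 n2]
    by (intro bij_betw_cong[THEN iffD1, OF _ g]) (auto simp: \<phi>_def)
  have c: "\<phi> {Center1, Center2} = e"
    by (simp add: \<phi>_def spokes_disjoint)
  have "bij_betw \<phi> (spokes1 n1 \<union> spokes2 n2) ((E1 - {e}) \<union> (E2 - {e}))"
    using 1 2 assms(3) by (intro bij_betw_combine) auto
  moreover have "bij_betw \<phi> {{Center1, Center2}} {e}"
    by (simp add: c bij_betw_def)
  ultimately have
    "bij_betw \<phi> ((spokes1 n1 \<union> spokes2 n2) \<union> {{Center1, Center2}}) ((E1 - {e}) \<union> (E2 - {e}) \<union> {e})"
    by (rule bij_betw_combine) auto
  moreover have "(E1 - {e}) \<union> (E2 - {e}) \<union> {e} = E"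
    using assms(2) e by auto
  ultimately have "bij_betw \<phi> (edges (CB n1 n2)) E"
    by (simp add: edges_CB)
  moreover have "\<phi> ` insert {Center1, Center2} (spokes1 n1) = E1"
      "\<phi> ` insert {Center1, Center2} (spokes2 n2) = E2"
    using 1 2 e by (auto simp: c bij_betw_def)
  ultimately show ?thesis by blast
qed

section \<open>Counting edges and the characterisation of friendliness\<close>

lemma tree_finite_edges: "tree G \<Longrightarrow> finite (edges G)"
  by (rule finite_subset[of _ "Pow (verts G)"]) (auto simp: tree_def simple_graph_def)

theorem mainTheorem3:
  fixes n1 n2 :: nat and G :: "'a ugraph"
  assumes "n1 \<ge> 1" and "n2 \<ge> 1" and "tree G"
  shows "friendly (CB n1 n2) G \<longleftrightarrow>
    card (edges G) = n1 + n2 - 1 \<and>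
    (\<exists>H1 H2. subtree H1 G \<and> subtree H2 G \<and>
       (\<exists>e. edges H1 \<inter> edges H2 = {e}) \<and>
       card (edges H1) = n1 \<and> card (edges H2) = n2)"
    (is "?L \<longleftrightarrow> ?R")
proof
  let ?c = "{Center1, Center2}"
  assume ?L
  then obtain \<phi> where "friendly_bijection (CB n1 n2) G \<phi>"
    by (auto simp: friendly_def)
  then obtain H1 H2 where bij: "bij_betw \<phi> (edges (CB n1 n2)) (edges G)"
      and H: "subtree H1 G" "subtree H2 G" "edges H1 = \<phi> ` insert ?c (spokes1 n1)"
        "edges H2 = \<phi> ` insert ?c (spokes2 n2)"
    unfolding friendly_bijection_CB_iff[OF assms(3)] by metis
  have inj: "inj_on \<phi> (edges (CB n1 n2))" using bij by (simp add: bij_betw_def)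
  have sub: "insert ?c (spokes1 n1) \<subseteq> edges (CB n1 n2)" "insert ?c (spokes2 n2) \<subseteq> edges (CB n1 n2)"
    by (auto simp: edges_CB)
  have "insert ?c (spokes1 n1) \<inter> insert ?c (spokes2 n2) = {?c}"
    using spokes_disjoint(1)[of n1 n2] spokes_disjoint(2)[of n1] spokes_disjoint(3)[of n2] by blast
  then have "edges H1 \<inter> edges H2 = {\<phi> ?c}"
    using inj_on_image_Int[OF inj sub] H(3,4) by (metis image_insert image_empty)
  \<comment> \<open>Each star has its spokes and the common edge; \<open>n1 \<ge> 1\<close> and
    \<open>n2 \<ge> 1\<close> keep the subtraction in \<open>card_spokes\<close> from being
    truncated.\<close>
  moreover have "card (edges H1) = n1" "card (edges H2) = n2"
    using assms(1,2) inj_on_subset[OF inj sub(1)] inj_on_subset[OF inj sub(2)]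
    by (simp_all only: H card_image) (simp_all add: finite_spokes spokes_disjoint card_spokes)
  moreover have "card (edges G) = n1 + n2 - 1"
    using bij_betw_same_card[OF bij] assms(1,2)
    by (simp add: edges_CB finite_spokes spokes_disjoint card_Un_disjoint card_spokes)
  ultimately show ?R using H by blast
next
  assume ?R
  then obtain H1 H2 e where H: "subtree H1 G" "subtree H2 G" "edges H1 \<inter> edges H2 = {e}"
      "card (edges H1) = n1" "card (edges H2) = n2" and cG: "card (edges G) = n1 + n2 - 1"
    by blast
  have fin: "finite (edges G)" using assms(3) by (rule tree_finite_edges)
  have sub: "edges H1 \<subseteq> edges G" "edges H2 \<subseteq> edges G"
    using H by (auto simp: subtree_def)
  \<comment> \<open>The single common edge is counted twice in \<open>n1 + n2\<close>, so the union
    has \<open>n1 + n2 - 1\<close> edges and must exhaust \<open>edges G\<close>.\<close>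
  then have "card (edges H1 \<union> edges H2) = card (edges G)"
    using card_Un_Int[OF sub[THEN finite_subset, OF fin]] H cG by simp
  then have "edges H1 \<union> edges H2 = edges G"
    using fin sub by (intro card_subset_eq) auto
  then obtain \<phi> where "bij_betw \<phi> (edges (CB n1 n2)) (edges G)"
      "\<phi> ` insert {Center1, Center2} (spokes1 n1) = edges H1"
      "\<phi> ` insert {Center1, Center2} (spokes2 n2) = edges H2"
    using bij_betw_CB_edges_exists[OF fin _ H(3,4,5)] by blast
  then have "friendly_bijection (CB n1 n2) G \<phi>"
    \<comment> \<open>Without \<open>image_insert\<close> the images of the stars keep the form in
      which they were obtained, so that \<open>H1\<close> and \<open>H2\<close> serve as
      witnesses.\<close>
    using H(1,2) by (auto simp: friendly_bijection_CB_iff[OF assms(3)] simp del: image_insert)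
  then show ?L by (auto simp: friendly_def)
qed

end
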